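(* Let $(Q,P)$ be a weakly quasi-lattice ordered group and let $\Lambda$ be a $P$-graph with $\mathrm{FA}(\Lambda)\neq\emptyset$. Let $\mathcal{X}(\Lambda)*P=\{(x,m)\in\mathcal{X}(\Lambda)\times P: x\cap\Lambda^m\neq\emptyset\}$ and define $T:\mathcal{X}(\Lambda)*P\to\mathcal{X}(\Lambda)$ by $T(x,m)=x\cdot m:=\{\mu\in\Lambda: x(0,m)\mu\in x\}$, where $x(0,m)$ is the unique element of $x\cap\Lambda^m$. Then $(\mathcal{X}(\Lambda),P,T)$ is a locally compact and directed semigroup action.
   Context: $(Q,P)$ weakly quasi-lattice ordered: $Q$ a discrete group, $P\subseteq Q$ a subsemigroup containing the identity $e$ with $P\cap P^{-1}=\{e\}$, and with $p\le r$ meaning $pq=r$ for some $q\in P$, any two elements of $P$ with a common upper bound have a least common upper bound. A $P$-graph is a countable small category $\Lambda$ (identities $\Lambda^{(0)}$, range/source $r,s$) with a functor $d:\Lambda\to P$ with unique factorisation: if $d(\lambda)=pq$ there are unique $\mu,\nu$ with $\lambda=\mu\nu$, $d(\mu)=p$, $d(\nu)=q$. Write $\Lambda^m=d^{-1}(m)$, $\lambda\Lambda=\{\lambda\mu: s(\lambda)=r(\mu)\}$, $\mu\preceq\lambda$ iff $\lambda\in\mu\Lambda$. $\Lambda$ is finitely aligned at $(\mu,\nu)$ if $\mu\Lambda\cap\nu\Lambda=\bigcup_{\lambda\in J}\lambda\Lambda$ for some finite $J\subseteq\Lambda$; $\mathrm{FA}(\Lambda)$ is the set of $\lambda$ such that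 $\Lambda$ is finitely aligned at $(\mu,\nu)$ for all $\mu\in\lambda\Lambda$, $\nu\in\Lambda$. A filter is a nonempty hereditary ($\lambda\preceq\mu\in x\Rightarrow\lambda\in x$) and directed (any two elements have a common $\preceq$-upper bound in $x$) subset of $\Lambda$; $\mathcal{F}(\Lambda)$ is the set of filters; for a filter $x$, $d|_x$ is injective, so $x\cap\Lambda^m$ has at most one element. $\mathcal{P}(\Lambda)$ has the product topology from $\{0,1\}^\Lambda$ (basis: $\{x: K_1\subseteq x\subseteq\Lambda\setminus K_2\}$, $K_1,K_2$ finite), and subsets have subspace topology. The path space is $\mathcal{X}(\Lambda)=\{x\in\mathcal{F}(\Lambda): x\cap\mathrm{FA}(\Lambda)\neq\emptyset\}$. A semigroup action of $P$ on a set $X$ is a pair of a subset $X*P\subseteq X\times P$ and a map $T:X*P\to X$, $(x,m)\mapsto x\cdot m$, such that (S1) $(x,e)\in X*P$ and $x\cdot e=x$ for all $x$; (S2) $(x,mn)\in X*P$ iff $(x,m)\in X*P$ and $(x\cdot m,n)\in X*P$, in which case $(x\cdot m)\cdot n=x\cdot(mn)$. Write $\mathrm{dom}(m)=\{x:(x,m)\in X*P\}$, $\mathrm{cod}(m)=\{x\cdot m: x\in\mathrm{dom}(m)\}$, $T_m:\mathrm{dom}(m)\to\mathrm{cod}(m)$, $T_m(x)=x\cdot m$. The action is directed if whenever $\mathrm{dom}(m)\cap\mathrm{dom}(n)\neq\emptyset$ there is $l\in P$ with $m,n\le l$ and $\mathrm{dom}(m)\cap\mathrm{dom}(n)\subseteq\mathrm{dom}(l)$.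 It is locally compact if $X$ is a locally compact Hausdorff space and for all $m\in P$ the sets $\mathrm{dom}(m),\mathrm{cod}(m)$ are open in $X$ and $T_m$ is a local homeomorphism. *)

theory Defs
  imports "HOL-Analysis.Analysis"
begin

(* The discrete group Q is a type of class group_add; the group operation is written +
   (not assumed commutative), identity e = 0, inverse = uminus. *)

definition pleq :: "'q::group_add set \<Rightarrow> 'q \<Rightarrow> 'q \<Rightarrow> bool" where
  "pleq P p r \<longleftrightarrow> (\<exists>q\<in>P. p + q = r)"

definition weakly_qlo :: "'q::group_add set \<Rightarrow> bool" where
  "weakly_qlo P \<longleftrightarrow>
     0 \<in> P \<and> (\<forall>p\<in>P. \<forall>q\<in>P. p + q \<in> P) \<and> P \<inter> uminus ` P = {0} \<and>
     (\<forall>p\<in>P. \<forall>q\<in>P. (\<exists>u\<in>P. pleq P p u \<and> pleq P q u) \<longrightarrow>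
        (\<exists>l\<in>P. pleq P p l \<and> pleq P q l \<and>
            (\<forall>u\<in>P. pleq P p u \<and> pleq P q u \<longrightarrow> pleq P l u)))"

(* A small category with morphism set Lam; objects are identity morphisms;
   r = range (codomain), s = source; cmp la mu = lamu is defined when s la = r mu. *)
definition vertices :: "'a set \<Rightarrow> ('a \<Rightarrow> 'a) \<Rightarrow> ('a \<Rightarrow> 'a) \<Rightarrow> 'a set" where
  "vertices Lam r s = r ` Lam \<union> s ` Lam"

definition small_category ::
  "'a set \<Rightarrow> ('a \<Rightarrow> 'a) \<Rightarrow> ('a \<Rightarrow> 'a) \<Rightarrow> ('a \<Rightarrow> 'a \<Rightarrow> 'a) \<Rightarrow> bool" where
  "small_category Lam r s cmp \<longleftrightarrow>
     vertices Lam r s \<subseteq> Lam \<and>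
     (\<forall>v\<in>vertices Lam r s. r v = v \<and> s v = v) \<and>
     (\<forall>la\<in>Lam. \<forall>mu\<in>Lam. s la = r mu \<longrightarrow>
        cmp la mu \<in> Lam \<and> r (cmp la mu) = r la \<and> s (cmp la mu) = s mu) \<and>
     (\<forall>la\<in>Lam. \<forall>mu\<in>Lam. \<forall>nu\<in>Lam. s la = r mu \<longrightarrow> s mu = r nu \<longrightarrow>
        cmp (cmp la mu) nu = cmp la (cmp mu nu)) \<and>
     (\<forall>la\<in>Lam. cmp (r la) la = la \<and> cmp la (s la) = la)"

definition P_graph ::
  "'q::group_add set \<Rightarrow> 'a set \<Rightarrow> ('a \<Rightarrow> 'a) \<Rightarrow> ('a \<Rightarrow> 'a) \<Rightarrow> ('a \<Rightarrow> 'a \<Rightarrow> 'a)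
     \<Rightarrow> ('a \<Rightarrow> 'q) \<Rightarrow> bool" where
  "P_graph P Lam r s cmp d \<longleftrightarrow>
     countable Lam \<and> small_category Lam r s cmp \<and>
     (\<forall>la\<in>Lam. d la \<in> P) \<and>
     (\<forall>v\<in>vertices Lam r s. d v = 0) \<and>
     (\<forall>la\<in>Lam. \<forall>mu\<in>Lam. s la = r mu \<longrightarrow> d (cmp la mu) = d la + d mu) \<and>
     (\<forall>la\<in>Lam. \<forall>p\<in>P. \<forall>q\<in>P. d la = p + q \<longrightarrow>
        (\<exists>!(mu, nu). mu \<in> Lam \<and> nu \<in> Lam \<and> s mu = r nu \<and>
            cmp mu nu = la \<and> d mu = p \<and> d nu = q))"

definition deg_set :: "'a set \<Rightarrow> ('a \<Rightarrow> 'q) \<Rightarrow> 'q \<Rightarrow> 'a set" where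
  "deg_set Lam d m = {la\<in>Lam. d la = m}"

definition right_ext :: "'a set \<Rightarrow> ('a \<Rightarrow> 'a) \<Rightarrow> ('a \<Rightarrow> 'a) \<Rightarrow> ('a \<Rightarrow> 'a \<Rightarrow> 'a) \<Rightarrow> 'a \<Rightarrow> 'a set" where
  "right_ext Lam r s cmp la = {cmp la mu | mu. mu \<in> Lam \<and> s la = r mu}"

definition prec :: "'a set \<Rightarrow> ('a \<Rightarrow> 'a) \<Rightarrow> ('a \<Rightarrow> 'a) \<Rightarrow> ('a \<Rightarrow> 'a \<Rightarrow> 'a) \<Rightarrow> 'a \<Rightarrow> 'a \<Rightarrow> bool" where
  "prec Lam r s cmp mu la \<longleftrightarrow> la \<in> right_ext Lam r s cmp mu"

definition fin_aligned_at ::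
  "'a set \<Rightarrow> ('a \<Rightarrow> 'a) \<Rightarrow> ('a \<Rightarrow> 'a) \<Rightarrow> ('a \<Rightarrow> 'a \<Rightarrow> 'a) \<Rightarrow> 'a \<Rightarrow> 'a \<Rightarrow> bool" where
  "fin_aligned_at Lam r s cmp mu nu \<longleftrightarrow>
     (\<exists>J. finite J \<and> J \<subseteq> Lam \<and>
        right_ext Lam r s cmp mu \<inter> right_ext Lam r s cmp nu = (\<Union>la\<in>J. right_ext Lam r s cmp la))"

definition FA :: "'a set \<Rightarrow> ('a \<Rightarrow> 'a) \<Rightarrow> ('a \<Rightarrow> 'a) \<Rightarrow> ('a \<Rightarrow> 'a \<Rightarrow> 'a) \<Rightarrow> 'a set" where
  "FA Lam r s cmp = {la\<in>Lam. \<forall>mu\<in>right_ext Lam r s cmp la. \<forall>nu\<in>Lam. fin_aligned_at Lam r s cmp mu nu}"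

definition is_filter :: "'a set \<Rightarrow> ('a \<Rightarrow> 'a) \<Rightarrow> ('a \<Rightarrow> 'a) \<Rightarrow> ('a \<Rightarrow> 'a \<Rightarrow> 'a) \<Rightarrow> 'a set \<Rightarrow> bool" where
  "is_filter Lam r s cmp x \<longleftrightarrow>
     x \<subseteq> Lam \<and> x \<noteq> {} \<and>
     (\<forall>mu\<in>x. \<forall>la\<in>Lam. prec Lam r s cmp la mu \<longrightarrow> la \<in> x) \<and>
     (\<forall>la\<in>x. \<forall>mu\<in>x. \<exists>nu\<in>x. prec Lam r s cmp la nu \<and> prec Lam r s cmp mu nu)"

definition path_space :: "'a set \<Rightarrow> ('a \<Rightarrow> 'a) \<Rightarrow> ('a \<Rightarrow> 'a) \<Rightarrow> ('a \<Rightarrow> 'a \<Rightarrow> 'a) \<Rightarrow> 'a set set" where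
  "path_space Lam r s cmp =
     {x. is_filter Lam r s cmp x \<and> x \<inter> FA Lam r s cmp \<noteq> {}}"

definition powerset_top :: "'a set \<Rightarrow> 'a set topology" where
  "powerset_top Lam = topology_generated_by
     {{x. x \<subseteq> Lam \<and> K1 \<subseteq> x \<and> x \<subseteq> Lam - K2} | K1 K2.
        finite K1 \<and> finite K2 \<and> K1 \<subseteq> Lam \<and> K2 \<subseteq> Lam}"

definition path_top :: "'a set \<Rightarrow> ('a \<Rightarrow> 'a) \<Rightarrow> ('a \<Rightarrow> 'a) \<Rightarrow> ('a \<Rightarrow> 'a \<Rightarrow> 'a) \<Rightarrow> 'a set topology" where
  "path_top Lam r s cmp = subtopology (powerset_top Lam) (path_space Lam r s cmp)"

definition seg :: "'a set \<Rightarrow> ('a \<Rightarrow> 'q) \<Rightarrow> 'a set \<Rightarrow> 'q \<Rightarrow> 'a" where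
  "seg Lam d x m = (THE la. la \<in> x \<inter> deg_set Lam d m)"

definition path_act_dom ::
  "'q set \<Rightarrow> 'a set \<Rightarrow> ('a \<Rightarrow> 'a) \<Rightarrow> ('a \<Rightarrow> 'a) \<Rightarrow> ('a \<Rightarrow> 'a \<Rightarrow> 'a) \<Rightarrow> ('a \<Rightarrow> 'q)
     \<Rightarrow> ('a set \<times> 'q) set" where
  "path_act_dom P Lam r s cmp d =
     {(x, m). x \<in> path_space Lam r s cmp \<and> m \<in> P \<and> x \<inter> deg_set Lam d m \<noteq> {}}"

definition path_shift ::
  "'a set \<Rightarrow> ('a \<Rightarrow> 'a) \<Rightarrow> ('a \<Rightarrow> 'a) \<Rightarrow> ('a \<Rightarrow> 'a \<Rightarrow> 'a) \<Rightarrow> ('a \<Rightarrow> 'q)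
     \<Rightarrow> 'a set \<Rightarrow> 'q \<Rightarrow> 'a set" where
  "path_shift Lam r s cmp d x m =
     {mu\<in>Lam. s (seg Lam d x m) = r mu \<and> cmp (seg Lam d x m) mu \<in> x}"

definition act_dom :: "('x \<times> 'q) set \<Rightarrow> 'q \<Rightarrow> 'x set" where
  "act_dom XP m = {x. (x, m) \<in> XP}"

definition act_cod :: "('x \<times> 'q) set \<Rightarrow> ('x \<Rightarrow> 'q \<Rightarrow> 'x) \<Rightarrow> 'q \<Rightarrow> 'x set" where
  "act_cod XP T m = (\<lambda>x. T x m) ` act_dom XP m"

definition semigroup_action ::
  "'q::group_add set \<Rightarrow> 'x set \<Rightarrow> ('x \<times> 'q) set \<Rightarrow> ('x \<Rightarrow> 'q \<Rightarrow> 'x) \<Rightarrow> bool" where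
  "semigroup_action P X XP T \<longleftrightarrow>
     XP \<subseteq> X \<times> P \<and>
     (\<forall>x\<in>X. \<forall>m\<in>P. (x, m) \<in> XP \<longrightarrow> T x m \<in> X) \<and>
     (\<forall>x\<in>X. (x, 0) \<in> XP \<and> T x 0 = x) \<and>
     (\<forall>x\<in>X. \<forall>m\<in>P. \<forall>n\<in>P.
        ((x, m + n) \<in> XP \<longleftrightarrow> (x, m) \<in> XP \<and> (T x m, n) \<in> XP) \<and>
        ((x, m + n) \<in> XP \<longrightarrow> T (T x m) n = T x (m + n)))"

definition directed_action ::
  "'q::group_add set \<Rightarrow> ('x \<times> 'q) set \<Rightarrow> bool" where
  "directed_action P XP \<longleftrightarrow>
     (\<forall>m\<in>P. \<forall>n\<in>P. act_dom XP m \<inter> act_dom XP n \<noteq> {} \<longrightarrow>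
        (\<exists>l\<in>P. pleq P m l \<and> pleq P n l \<and>
            act_dom XP m \<inter> act_dom XP n \<subseteq> act_dom XP l))"

definition local_homeo_on :: "'x topology \<Rightarrow> 'x set \<Rightarrow> 'x set \<Rightarrow> ('x \<Rightarrow> 'x) \<Rightarrow> bool" where
  "local_homeo_on X A B f \<longleftrightarrow>
     f ` A \<subseteq> B \<and>
     (\<forall>a\<in>A. \<exists>U. a \<in> U \<and> openin (subtopology X A) U \<and>
        openin (subtopology X B) (f ` U) \<and>
        homeomorphic_map (subtopology X U) (subtopology X (f ` U)) f)"

definition locally_compact_action ::
  "'q::group_add set \<Rightarrow> 'x topology \<Rightarrow> ('x \<times> 'q) set \<Rightarrow> ('x \<Rightarrow> 'q \<Rightarrow> 'x) \<Rightarrow> bool" where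
  "locally_compact_action P X XP T \<longleftrightarrow>
     locally_compact_space X \<and> Hausdorff_space X \<and>
     (\<forall>m\<in>P. openin X (act_dom XP m) \<and> openin X (act_cod XP T m) \<and>
        local_homeo_on X (act_dom XP m) (act_cod XP T m) (\<lambda>x. T x m))"

end

(* Everything rests on two facts. First, FA is closed under extension, and cancelling a prefix
   of an element of FA leaves an element of FA; hence a filter in the path space contains
   la mu in FA with la any prescribed member, and mu is in FA.
   Second, the filters through an element of FA form a compact open cylinder: finite
   alignment says that two members of a limit set have a common upper bound inside a fixed finite
   set, and a finite disjunction of memberships passes to limits.
   The shift by d la maps the cylinder of la mu bijectively and continuously onto the
   cylinder of mu, so it is a homeomorphism there by compactness. *)
theory Submission
  imports Defs
begin

section \<open>Subsets of a set under pointwise convergence\<close>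

lemma topspace_powerset_top: "topspace (powerset_top S) = Pow S"
  unfolding powerset_top_def topology_generated_by_topspace by blast

lemma openin_powerset_top_basis:
  assumes "finite K1" "finite K2" "K1 \<subseteq> S" "K2 \<subseteq> S"
  shows "openin (powerset_top S) {x. x \<subseteq> S \<and> K1 \<subseteq> x \<and> x \<subseteq> S - K2}"
  unfolding powerset_top_def using assms by (intro topology_generated_by_Basis) blast

lemma openin_powerset_top_mem:
  assumes "a \<in> S"
  shows "openin (powerset_top S) {x. x \<subseteq> S \<and> a \<in> x}"
proof -
  have "{x. x \<subseteq> S \<and> a \<in> x} = {x. x \<subseteq> S \<and> {a} \<subseteq> x \<and> x \<subseteq> S - {}}" by blast
  then show ?thesis using openin_powerset_top_basis[of "{a}" "{}" S] assms by simp
qed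

lemma openin_powerset_top_not_mem:
  assumes "a \<in> S"
  shows "openin (powerset_top S) {x. x \<subseteq> S \<and> a \<notin> x}"
proof -
  have "{x. x \<subseteq> S \<and> a \<notin> x} = {x. x \<subseteq> S \<and> {} \<subseteq> x \<and> x \<subseteq> S - {a}}" by blast
  then show ?thesis using openin_powerset_top_basis[of "{}" "{a}" S] assms by simp
qed

text \<open>The sets given by one membership or one non-membership form a subbasis, so continuity
  can be tested one element of \<open>S\<close> at a time.\<close>

lemma continuous_map_powerset_top:
  assumes f: "\<And>x. x \<in> topspace X \<Longrightarrow> f x \<subseteq> S"
    and mem: "\<And>a. a \<in> S \<Longrightarrow> openin X {x \<in> topspace X. a \<in> f x}"
    and not_mem: "\<And>a. a \<in> S \<Longrightarrow> openin X {x \<in> topspace X. a \<notin> f x}"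
  shows "continuous_map X (powerset_top S) f"
  unfolding powerset_top_def
proof (rule continuous_on_generated_topo)
  fix U
  assume "U \<in> {{x. x \<subseteq> S \<and> K1 \<subseteq> x \<and> x \<subseteq> S - K2} | K1 K2.
        finite K1 \<and> finite K2 \<and> K1 \<subseteq> S \<and> K2 \<subseteq> S}"
  then obtain K1 K2 where K: "finite K1" "finite K2" "K1 \<subseteq> S" "K2 \<subseteq> S"
    and U: "U = {x. x \<subseteq> S \<and> K1 \<subseteq> x \<and> x \<subseteq> S - K2}" by blast
  \<comment> \<open>Each intersection is cut down to the whole space so that empty \<open>K1\<close>
    or \<open>K2\<close> gives \<open>topspace X\<close> and not the universe.\<close>
  have eq: "f -` U \<inter> topspace X =
      ((\<Inter>a\<in>K1. {x \<in> topspace X. a \<in> f x}) \<inter> topspace X)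
      \<inter> ((\<Inter>a\<in>K2. {x \<in> topspace X. a \<notin> f x}) \<inter> topspace X)"
    unfolding U using f by (auto simp: subset_iff)
  show "openin X (f -` U \<inter> topspace X)"
    unfolding eq
  proof (rule openin_Int)
    show "openin X ((\<Inter>a\<in>K1. {x \<in> topspace X. a \<in> f x}) \<inter> topspace X)"
      using K mem by (intro openin_INT) auto
    show "openin X ((\<Inter>a\<in>K2. {x \<in> topspace X. a \<notin> f x}) \<inter> topspace X)"
      using K not_mem by (intro openin_INT) auto
  qed
next
  show "f ` topspace X \<subseteq> \<Union> {{x. x \<subseteq> S \<and> K1 \<subseteq> x \<and> x \<subseteq> S - K2} | K1 K2.
        finite K1 \<and> finite K2 \<and> K1 \<subseteq> S \<and> K2 \<subseteq> S}"
    using f by blast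
qed

text \<open>By Tychonoff, a product of copies of the two-point discrete space is compact; sending a
  characteristic function to its set is continuous and onto the power set.\<close>

lemma compact_space_powerset_top: "compact_space (powerset_top S)"
proof -
  let ?Y = "product_topology (\<lambda>_. discrete_topology (UNIV :: bool set)) S"
  let ?f = "\<lambda>g. {a \<in> S. g a}"
  have Y: "compact_space ?Y"
    by (simp add: compact_space_product_topology compact_space_discrete_topology)
  have coord: "openin ?Y {g \<in> topspace ?Y. g a \<in> V}" if "a \<in> S" for a V
    using openin_continuous_map_preimage[OF continuous_map_product_projection[OF that,
        of "\<lambda>_. discrete_topology (UNIV :: bool set)"], of V]
    by simp
  have "continuous_map ?Y (powerset_top S) ?f"
  proof (rule continuous_map_powerset_top)
    fix a assume a: "a \<in> S"
    show "openin ?Y {g \<in> topspace ?Y. a \<in> ?f g}" "openin ?Y {g \<in> topspace ?Y. a \<notin> ?f g}"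
      using coord[OF a, of "{True}"] coord[OF a, of "{False}"] a by simp_all
  qed blast
  moreover have "?f ` topspace ?Y = topspace (powerset_top S)"
  proof -
    have "x \<in> ?f ` topspace ?Y" if "x \<subseteq> S" for x
      \<comment> \<open>Points of the product are functions that are undefined off \<open>S\<close>,
        hence the restriction of the characteristic function.\<close>
      using that by (intro image_eqI[where x = "restrict (\<lambda>a. a \<in> x) S"]) auto
    then show ?thesis unfolding topspace_powerset_top by blast
  qed
  ultimately show ?thesis
    using Y image_compactin[of ?Y "topspace ?Y" "powerset_top S" ?f]
    unfolding compact_space_def by simp
qed

lemma Hausdorff_space_powerset_top: "Hausdorff_space (powerset_top S)"
  unfolding Hausdorff_space_def
proof (intro allI impI)
  fix x y :: "'a set"
  assume xy: "x \<in> topspace (powerset_top S) \<and> y \<in> topspace (powerset_top S) \<and> x \<noteq> y"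
  let ?I = "\<lambda>a. {z. z \<subseteq> S \<and> a \<in> z}" and ?O = "\<lambda>a. {z. z \<subseteq> S \<and> a \<notin> z}"
  have sub: "x \<subseteq> S" "y \<subseteq> S" using xy by (auto simp: topspace_powerset_top)
  \<comment> \<open>Distinct sets differ at some \<open>a\<close>; containing \<open>a\<close> and
    omitting \<open>a\<close> are disjoint open conditions.\<close>
  obtain a where a: "a \<in> S" "a \<in> x \<and> a \<notin> y \<or> a \<in> y \<and> a \<notin> x" using xy sub by blast
  have op: "openin (powerset_top S) (?I a)" "openin (powerset_top S) (?O a)"
    using openin_powerset_top_mem[OF a(1)] openin_powerset_top_not_mem[OF a(1)] .
  have "disjnt (?I a) (?O a)" "disjnt (?O a) (?I a)" by (auto simp: disjnt_def)
  then show "\<exists>U V. openin (powerset_top S) U \<and> openin (powerset_top S) V \<and>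
      x \<in> U \<and> y \<in> V \<and> disjnt U V"
    using a op sub by blast
qed

section \<open>Factorisation in P-graphs\<close>

locale p_graph =
  fixes P :: "'q::group_add set"
    and Lam :: "'a set" and r s :: "'a \<Rightarrow> 'a" and cmp :: "'a \<Rightarrow> 'a \<Rightarrow> 'a"  (infixl "\<cdot>" 70)
    and d :: "'a \<Rightarrow> 'q"
  assumes weakly_qlo: "weakly_qlo P"
    and P_graph: "P_graph P Lam r s cmp d"
begin

abbreviation ext where "ext \<equiv> right_ext Lam r s cmp"
abbreviation le (infix "\<preceq>" 50) where "le \<equiv> prec Lam r s cmp"
abbreviation falign where "falign \<equiv> FA Lam r s cmp"
abbreviation filt where "filt \<equiv> is_filter Lam r s cmp"
abbreviation X where "X \<equiv> path_space Lam r s cmp"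
abbreviation shift where "shift \<equiv> path_shift Lam r s cmp d"
abbreviation XP where "XP \<equiv> path_act_dom P Lam r s cmp d"
abbreviation XT where "XT \<equiv> path_top Lam r s cmp"

lemma r_in: "a \<in> Lam \<Longrightarrow> r a \<in> Lam" and s_in: "a \<in> Lam \<Longrightarrow> s a \<in> Lam"
  and s_r: "a \<in> Lam \<Longrightarrow> s (r a) = r a"
  and r_s: "a \<in> Lam \<Longrightarrow> r (s a) = s a"
  and r_cmp_id: "a \<in> Lam \<Longrightarrow> r a \<cdot> a = a" and cmp_s_id: "a \<in> Lam \<Longrightarrow> a \<cdot> s a = a"
proof -
  have v: "vertices Lam r s \<subseteq> Lam" "\<forall>v\<in>vertices Lam r s. r v = v \<and> s v = v"
    and u: "\<forall>a\<in>Lam. r a \<cdot> a = a \<and> a \<cdot> s a = a"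
    using P_graph unfolding P_graph_def small_category_def by - (elim conjE, assumption)+
  have "r a \<in> vertices Lam r s" "s a \<in> vertices Lam r s" if "a \<in> Lam" for a
    using that unfolding vertices_def by blast+
  then show "a \<in> Lam \<Longrightarrow> r a \<in> Lam" "a \<in> Lam \<Longrightarrow> s a \<in> Lam"
    "a \<in> Lam \<Longrightarrow> s (r a) = r a" "a \<in> Lam \<Longrightarrow> r (s a) = s a"
    "a \<in> Lam \<Longrightarrow> r a \<cdot> a = a" "a \<in> Lam \<Longrightarrow> a \<cdot> s a = a"
    using v u by auto
qed

lemma
  assumes "a \<in> Lam" "b \<in> Lam" "s a = r b"
  shows cmp_in: "a \<cdot> b \<in> Lam" and r_cmp: "r (a \<cdot> b) = r a" and s_cmp: "s (a \<cdot> b) = s b"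
    and d_cmp: "d (a \<cdot> b) = d a + d b"
proof -
  have "\<forall>a\<in>Lam. \<forall>b\<in>Lam. s a = r b \<longrightarrow>
      a \<cdot> b \<in> Lam \<and> r (a \<cdot> b) = r a \<and> s (a \<cdot> b) = s b"
    and "\<forall>a\<in>Lam. \<forall>b\<in>Lam. s a = r b \<longrightarrow> d (a \<cdot> b) = d a + d b"
    using P_graph unfolding P_graph_def small_category_def by - (elim conjE, assumption)+
  then show "a \<cdot> b \<in> Lam" "r (a \<cdot> b) = r a" "s (a \<cdot> b) = s b" "d (a \<cdot> b) = d a + d b"
    using assms by simp_all
qed

lemma cmp_assoc:
  assumes "a \<in> Lam" "b \<in> Lam" "c \<in> Lam" "s a = r b" "s b = r c"
  shows "a \<cdot> b \<cdot> c = a \<cdot> (b \<cdot> c)"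
  using P_graph assms unfolding P_graph_def small_category_def by blast

lemma d_in: "a \<in> Lam \<Longrightarrow> d a \<in> P"
  and d_r: "a \<in> Lam \<Longrightarrow> d (r a) = 0"
  using P_graph unfolding P_graph_def vertices_def by blast+

lemma unique_factorisation:
  assumes "a \<in> Lam" "p \<in> P" "q \<in> P" "d a = p + q"
  shows "\<exists>!(b, c). b \<in> Lam \<and> c \<in> Lam \<and> s b = r c \<and> b \<cdot> c = a \<and> d b = p \<and> d c = q"
  using P_graph assms unfolding P_graph_def by blast

lemma factorise:
  assumes "a \<in> Lam" "p \<in> P" "q \<in> P" "d a = p + q"
  obtains b c where "b \<in> Lam" "c \<in> Lam" "s b = r c" "b \<cdot> c = a" "d b = p" "d c = q"
  using unique_factorisation[OF assms] that by (auto elim!: ex1E)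

lemma factors_unique:
  assumes "a \<in> Lam" "b \<in> Lam" "s a = r b" "a' \<in> Lam" "b' \<in> Lam" "s a' = r b'"
    and eq: "a \<cdot> b = a' \<cdot> b'" and "d a = d a'"
  shows "a = a' \<and> b = b'"
proof -
  \<comment> \<open>Both sides are the degree of the common product. Left cancellation in the group
    makes the second degrees agree as well, so unique factorisation applies.\<close>
  have "d a + d b = d a + d b'" using assms d_cmp by metis
  then have "d b = d b'" by simp
  define Q where "Q = (\<lambda>(u, v). u \<in> Lam \<and> v \<in> Lam \<and> s u = r v \<and> u \<cdot> v = a \<cdot> b
      \<and> d u = d a \<and> d v = d b)"
  have "\<exists>!z. Q z"
    unfolding Q_def by (rule unique_factorisation) (use assms(1-3) d_in cmp_in d_cmp in auto)
  moreover have "Q (a, b)" "Q (a', b')"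
    unfolding Q_def using assms \<open>d b = d b'\<close> by simp_all
  ultimately have "(a, b) = (a', b')" by blast
  then show ?thesis by simp
qed

text \<open>Every morphism is monic: the two products are factorisations of one element with the
  same first degree.\<close>

lemma cmp_left_cancel:
  assumes "a \<in> Lam" "b \<in> Lam" "c \<in> Lam" "s a = r b" "s a = r c" "a \<cdot> b = a \<cdot> c"
  shows "b = c"
  using factors_unique assms by blast

section \<open>The prefix order\<close>

lemma le_iff: "a \<preceq> b \<longleftrightarrow> (\<exists>c\<in>Lam. s a = r c \<and> b = a \<cdot> c)"
  unfolding prec_def right_ext_def by blast

lemma ext_iff: "b \<in> ext a \<longleftrightarrow> a \<preceq> b"
  unfolding prec_def ..

lemma le_cmp: "b \<in> Lam \<Longrightarrow> s a = r b \<Longrightarrow> a \<preceq> a \<cdot> b"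
  unfolding le_iff by blast

lemma le_in: "a \<in> Lam \<Longrightarrow> a \<preceq> b \<Longrightarrow> b \<in> Lam"
  unfolding le_iff using cmp_in by blast

lemma le_range: "a \<in> Lam \<Longrightarrow> a \<preceq> b \<Longrightarrow> r b = r a"
  unfolding le_iff using r_cmp by blast

lemma le_refl: "a \<in> Lam \<Longrightarrow> a \<preceq> a"
  unfolding le_iff using s_in r_s cmp_s_id by metis

lemma le_trans:
  assumes "a \<in> Lam" "a \<preceq> b" "b \<preceq> c"
  shows "a \<preceq> c"
proof -
  obtain u v where "u \<in> Lam" "s a = r u" "b = a \<cdot> u" "v \<in> Lam" "s b = r v" "c = b \<cdot> v"
    using assms unfolding le_iff by blast
  then have "c = a \<cdot> (u \<cdot> v)" "s a = r (u \<cdot> v)" "u \<cdot> v \<in> Lam"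
    using assms s_cmp r_cmp cmp_in cmp_assoc by metis+
  then show ?thesis unfolding le_iff by blast
qed

text \<open>Left composition with \<open>a\<close> embeds the order on morphisms with range
  \<open>s a\<close>: a witness \<open>u\<close> for one side serves the other, by associativity and
  left cancellation.\<close>

lemma le_cmp_left_iff:
  assumes "a \<in> Lam" "b \<in> Lam" "c \<in> Lam" "s a = r b" "s a = r c"
  shows "a \<cdot> b \<preceq> a \<cdot> c \<longleftrightarrow> b \<preceq> c"
proof
  assume "a \<cdot> b \<preceq> a \<cdot> c"
  then obtain u where u: "u \<in> Lam" "s (a \<cdot> b) = r u" "a \<cdot> c = a \<cdot> b \<cdot> u" unfolding le_iff by blast
  then have "s b = r u" using assms s_cmp by metis
  then have "a \<cdot> c = a \<cdot> (b \<cdot> u)" "b \<cdot> u \<in> Lam" "s a = r (b \<cdot> u)"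
    using u assms cmp_assoc cmp_in r_cmp by metis+
  then have "c = b \<cdot> u" using cmp_left_cancel assms by metis
  then show "b \<preceq> c" using le_cmp u \<open>s b = r u\<close> by metis
next
  assume "b \<preceq> c"
  then obtain u where u: "u \<in> Lam" "s b = r u" "c = b \<cdot> u" unfolding le_iff by blast
  then have "a \<cdot> c = a \<cdot> b \<cdot> u" "s (a \<cdot> b) = r u" using assms cmp_assoc s_cmp by metis+
  then show "a \<cdot> b \<preceq> a \<cdot> c" using le_cmp u by metis
qed

lemma le_cmpE:
  assumes "a \<in> Lam" "b \<in> Lam" "s a = r b" "a \<cdot> b \<preceq> c"
  obtains c' where "c' \<in> Lam" "s a = r c'" "c = a \<cdot> c'" "b \<preceq> c'"
proof -
  have "a \<preceq> c" using assms le_cmp le_trans by blast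
  then obtain c' where "c' \<in> Lam" "s a = r c'" "c = a \<cdot> c'" unfolding le_iff by blast
  then show ?thesis using that assms le_cmp_left_iff by metis
qed

lemma le_degree: "a \<in> Lam \<Longrightarrow> a \<preceq> b \<Longrightarrow> pleq P (d a) (d b)"
  unfolding le_iff pleq_def using d_cmp d_in by metis

text \<open>Both are first factors of the same \<open>c\<close>, so unique factorisation identifies
  them. This is what makes the degree injective on a filter.\<close>

lemma le_degree_unique:
  assumes "a \<in> Lam" "b \<in> Lam" "a \<preceq> c" "b \<preceq> c" "d a = d b"
  shows "a = b"
  using assms factors_unique unfolding le_iff by blast

section \<open>Finitely aligned elements\<close>

lemma FA_in: "a \<in> falign \<Longrightarrow> a \<in> Lam"
  unfolding FA_def by blast

lemma FA_iff:
  "a \<in> falign \<longleftrightarrow> a \<in> Lam \<and> (\<forall>b. a \<preceq> b \<longrightarrow> (\<forall>c\<in>Lam. fin_aligned_at Lam r s cmp b c))"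
  unfolding FA_def by (auto simp: ext_iff)

lemma FA_upward:
  assumes "a \<in> falign" "a \<preceq> b"
  shows "b \<in> falign"
proof -
  have "a \<in> Lam" "b \<in> Lam" using assms FA_in le_in by blast+
  then show ?thesis using assms le_trans unfolding FA_iff by blast
qed

text \<open>Finite alignment in terms of the order: finitely many common extensions lie below all
  others. In this form it combines with the directedness of filters.\<close>

lemma FA_common_ext:
  assumes "a \<in> falign" "a \<preceq> b" "c \<in> Lam"
  obtains J where "finite J" "J \<subseteq> Lam" "\<And>u. u \<in> J \<Longrightarrow> b \<preceq> u \<and> c \<preceq> u"
    "\<And>v. b \<preceq> v \<Longrightarrow> c \<preceq> v \<Longrightarrow> \<exists>u\<in>J. u \<preceq> v"
proof -
  have "fin_aligned_at Lam r s cmp b c" using assms unfolding FA_iff by blast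
  then obtain J where J: "finite J" "J \<subseteq> Lam" "ext b \<inter> ext c = (\<Union>u\<in>J. ext u)"
    unfolding fin_aligned_at_def by blast
  show ?thesis
  proof (rule that[of J])
    fix u assume "u \<in> J"
    then have "u \<in> ext b \<inter> ext c" using J le_refl ext_iff by blast
    then show "b \<preceq> u \<and> c \<preceq> u" using ext_iff by blast
  next
    fix v assume "b \<preceq> v" "c \<preceq> v"
    then have "v \<in> (\<Union>u\<in>J. ext u)" using J ext_iff by blast
    then show "\<exists>u\<in>J. u \<preceq> v" using ext_iff by blast
  qed (use J in blast)+
qed

text \<open>Left composition with \<open>a\<close> identifies the morphisms with range
  \<open>s a\<close> with the extensions of \<open>a\<close>, order included, so a finite generating
  set pulls back along it.\<close>

lemma fin_aligned_at_cancel: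
  assumes "a \<in> Lam" "b \<in> Lam" "c \<in> Lam" "s a = r b" "s a = r c"
    and "fin_aligned_at Lam r s cmp (a \<cdot> b) (a \<cdot> c)"
  shows "fin_aligned_at Lam r s cmp b c"
proof -
  obtain J where J: "finite J" "J \<subseteq> Lam" "ext (a \<cdot> b) \<inter> ext (a \<cdot> c) = (\<Union>u\<in>J. ext u)"
    using assms(6) unfolding fin_aligned_at_def by blast
  define J' where "J' = {v \<in> Lam. s a = r v \<and> a \<cdot> v \<in> J}"
  have "inj_on (\<lambda>v. a \<cdot> v) J'"
    using assms(1) cmp_left_cancel unfolding inj_on_def J'_def by blast
  moreover have "(\<lambda>v. a \<cdot> v) ` J' \<subseteq> J" unfolding J'_def by blast
  ultimately have "finite J'" using J(1) inj_on_finite by blast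
  moreover have "ext b \<inter> ext c = (\<Union>v\<in>J'. ext v)"
  proof (intro subset_antisym subsetI)
    fix w assume "w \<in> ext b \<inter> ext c"
    then have w: "b \<preceq> w" "c \<preceq> w" using ext_iff by blast+
    then have "w \<in> Lam" "s a = r w" using assms le_in le_range by metis+
    then have "a \<cdot> b \<preceq> a \<cdot> w" "a \<cdot> c \<preceq> a \<cdot> w" using w assms le_cmp_left_iff by blast+
    then obtain u where u: "u \<in> J" "u \<preceq> a \<cdot> w" using J(3) ext_iff by blast
    then have "u \<in> Lam" using J by blast
    \<comment> \<open>By reflexivity a generator lies in the intersection it helps to generate; so
      it begins with \<open>a\<close>, and its remainder is in \<open>J'\<close>.\<close>
    then have "u \<in> ext (a \<cdot> b)" using J(3) u le_refl ext_iff by blast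
    then obtain v where v: "v \<in> Lam" "s a = r v" "u = a \<cdot> v"
      using le_cmpE assms ext_iff by metis
    then have "v \<preceq> w" using u le_cmp_left_iff assms \<open>w \<in> Lam\<close> \<open>s a = r w\<close> by blast
    then show "w \<in> (\<Union>v\<in>J'. ext v)" using v u ext_iff unfolding J'_def by blast
  next
    fix w assume "w \<in> (\<Union>v\<in>J'. ext v)"
    then obtain v where v: "v \<in> Lam" "s a = r v" "a \<cdot> v \<in> J" "v \<preceq> w"
      unfolding J'_def by (auto simp: ext_iff)
    then have "w \<in> Lam" "s a = r w" using le_in le_range by metis+
    then have "a \<cdot> v \<preceq> a \<cdot> w" using v assms le_cmp_left_iff by blast
    then have "a \<cdot> w \<in> ext (a \<cdot> b) \<inter> ext (a \<cdot> c)" using J(3) v ext_iff by blast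
    then show "w \<in> ext b \<inter> ext c"
      using assms le_cmp_left_iff \<open>w \<in> Lam\<close> \<open>s a = r w\<close> ext_iff by blast
  qed
  moreover have "J' \<subseteq> Lam" unfolding J'_def by blast
  ultimately show ?thesis unfolding fin_aligned_at_def by blast
qed

text \<open>If \<open>v\<close> can be composed with \<open>a\<close>, alignment holds after
  prepending \<open>a\<close> and is pulled back. Otherwise \<open>c\<close> and \<open>v\<close>
  have different ranges and no common extension, and the empty set generates.\<close>

lemma FA_cancel:
  assumes "a \<in> Lam" "b \<in> Lam" "s a = r b" "a \<cdot> b \<in> falign"
  shows "b \<in> falign"
proof -
  have "fin_aligned_at Lam r s cmp c v" if c: "b \<preceq> c" and v: "v \<in> Lam" for c v
  proof (cases "r v = s a")
    case True
    have cL: "c \<in> Lam" "s a = r c" using c assms le_in le_range by metis+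
    then have "a \<cdot> b \<preceq> a \<cdot> c" using c assms le_cmp_left_iff by blast
    moreover have "a \<cdot> v \<in> Lam" using True v assms cmp_in by metis
    ultimately have "fin_aligned_at Lam r s cmp (a \<cdot> c) (a \<cdot> v)"
      using assms(4) unfolding FA_iff by blast
    then show ?thesis using fin_aligned_at_cancel True cL v assms by metis
  next
    case False
    have "r c = s a" using c assms le_range by metis
    then have "ext c \<inter> ext v = {}"
      using False c v le_range le_in[OF assms(2)] by (metis disjoint_iff ext_iff)
    then show ?thesis unfolding fin_aligned_at_def by (intro exI[of _ "{}"]) simp
  qed
  then show ?thesis using assms(2) unfolding FA_iff by blast
qed

section \<open>Filters, and the shift\<close>

lemma filt_sub: "filt x \<Longrightarrow> a \<in> x \<Longrightarrow> a \<in> Lam"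
  unfolding is_filter_def by blast

lemma filt_down: "filt x \<Longrightarrow> a \<in> Lam \<Longrightarrow> a \<preceq> b \<Longrightarrow> b \<in> x \<Longrightarrow> a \<in> x"
  unfolding is_filter_def by blast

lemma filt_directed:
  assumes "filt x" "a \<in> x" "b \<in> x"
  obtains c where "c \<in> x" "a \<preceq> c" "b \<preceq> c"
  using assms unfolding is_filter_def by blast

lemma filt_common_range:
  assumes "filt x" "a \<in> x" "b \<in> x"
  shows "r a = r b"
  using filt_directed[OF assms] le_range filt_sub assms by metis

lemma filt_degree_unique:
  assumes "filt x" "a \<in> x" "b \<in> x" "d a = d b"
  shows "a = b"
  using filt_directed[OF assms(1-3)] le_degree_unique filt_sub assms by metis

lemma filt_directed_cmp:
  assumes "filt x" "a \<in> x" "b \<in> x"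
  obtains c where "c \<in> Lam" "s a = r c" "a \<cdot> c \<in> x" "b \<preceq> a \<cdot> c"
  using filt_directed[OF assms] le_iff by metis

lemma path_space_filt: "x \<in> X \<Longrightarrow> filt x"
  unfolding path_space_def by blast

lemma path_space_sub: "X \<subseteq> Pow Lam"
  unfolding path_space_def is_filter_def by blast

text \<open>Directedness bounds \<open>a\<close> and a finitely aligned member \<open>k\<close> by
  some \<open>a \<cdot> b\<close> in \<open>x\<close>, which inherits finite alignment from
  \<open>k\<close>; cancelling \<open>a\<close> passes it on to \<open>b\<close>.\<close>

lemma path_space_FA_extension:
  assumes "x \<in> X" "a \<in> x"
  obtains b where "b \<in> Lam" "s a = r b" "a \<cdot> b \<in> x" "a \<cdot> b \<in> falign" "b \<in> falign"
proof -
  obtain k where k: "k \<in> x" "k \<in> falign" using assms unfolding path_space_def by blast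
  obtain b where b: "b \<in> Lam" "s a = r b" "a \<cdot> b \<in> x" "k \<preceq> a \<cdot> b"
    using filt_directed_cmp[OF path_space_filt[OF assms(1)] assms(2) k(1)] by blast
  have "a \<in> Lam" using assms filt_sub path_space_filt by blast
  then show ?thesis using that b k FA_upward FA_cancel by metis
qed

lemma seg_eq:
  assumes "filt x" "a \<in> x"
  shows "seg Lam d x (d a) = a"
  unfolding seg_def
proof (rule the_equality)
  show "a \<in> x \<inter> deg_set Lam d (d a)" using assms filt_sub unfolding deg_set_def by blast
  show "b = a" if "b \<in> x \<inter> deg_set Lam d (d a)" for b
    using that assms filt_degree_unique unfolding deg_set_def by blast
qed

text \<open>Degrees determine members of a filter, so \<open>a\<close> is the segment of degree
  \<open>d a\<close>. Writing shifts as \<open>shift x (d a)\<close> with \<open>a\<close> in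
  \<open>x\<close> removes \<open>seg\<close> from all later arguments.\<close>

lemma mem_shift:
  assumes "filt x" "a \<in> x"
  shows "b \<in> shift x (d a) \<longleftrightarrow> b \<in> Lam \<and> s a = r b \<and> a \<cdot> b \<in> x"
  unfolding path_shift_def seg_eq[OF assms] by blast

lemma mem_XP: "(x, m) \<in> XP \<longleftrightarrow> x \<in> X \<and> (\<exists>a\<in>x. d a = m)"
proof -
  have "m \<in> P \<and> x \<inter> deg_set Lam d m \<noteq> {} \<longleftrightarrow> (\<exists>a\<in>x. d a = m)" if "x \<in> X"
    using filt_sub[OF path_space_filt[OF that]] d_in unfolding deg_set_def by blast
  then show ?thesis unfolding path_act_dom_def by blast
qed

lemma filt_shift:
  assumes x: "filt x" and a: "a \<in> x"
  shows "filt (shift x (d a))"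
proof -
  note mem = mem_shift[OF x a]
  have aL: "a \<in> Lam" using x a filt_sub by blast
  have "s a \<in> shift x (d a)" using mem aL a s_in r_s cmp_s_id by simp
  moreover have "c \<in> shift x (d a)" if b: "b \<in> shift x (d a)" and c: "c \<in> Lam" "c \<preceq> b" for b c
  proof -
    have "s a = r c" using b c mem le_range by metis
    then have "a \<cdot> c \<preceq> a \<cdot> b" "a \<cdot> c \<in> Lam" using b c mem aL le_cmp_left_iff cmp_in by blast+
    then show ?thesis using mem filt_down[OF x] b c \<open>s a = r c\<close> by blast
  qed
  moreover have "\<exists>u\<in>shift x (d a). b \<preceq> u \<and> c \<preceq> u"
    if b: "b \<in> shift x (d a)" and c: "c \<in> shift x (d a)" for b c
  proof -
    obtain w where w: "w \<in> x" "a \<cdot> b \<preceq> w" "a \<cdot> c \<preceq> w"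
      using filt_directed[OF x] b c mem by metis
    \<comment> \<open>An upper bound of \<open>a \<cdot> b\<close> begins with \<open>a\<close>;
      removing that prefix gives an upper bound inside the shift.\<close>
    obtain u where u: "u \<in> Lam" "s a = r u" "w = a \<cdot> u" "b \<preceq> u"
      using le_cmpE w b mem aL by metis
    then have "c \<preceq> u" using w c mem aL le_cmp_left_iff by blast
    then show ?thesis using u w mem by blast
  qed
  moreover have "shift x (d a) \<subseteq> Lam" using mem by blast
  ultimately show ?thesis unfolding is_filter_def by blast
qed

lemma shift_in:
  assumes x: "x \<in> X" and a: "a \<in> x"
  shows "shift x (d a) \<in> X"
proof -
  note f = path_space_filt[OF x]
  obtain b where b: "b \<in> Lam" "s a = r b" "a \<cdot> b \<in> x" "b \<in> falign"
    using path_space_FA_extension[OF x a] by blast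
  then have "b \<in> shift x (d a)" using mem_shift[OF f a] by blast
  then show ?thesis using b filt_shift[OF f a] unfolding path_space_def by blast
qed

text \<open>The members that extend \<open>a\<close> are cofinal in a filter through
  \<open>a\<close>, and the shift records exactly these. Exchanging \<open>x\<close> and
  \<open>y\<close> gives equality.\<close>

lemma shift_inj:
  assumes x: "filt x" and y: "filt y" and a: "a \<in> x" "a \<in> y" and eq: "shift x (d a) = shift y (d a)"
  shows "x \<subseteq> y"
proof
  fix b assume b: "b \<in> x"
  obtain c where c: "c \<in> Lam" "s a = r c" "a \<cdot> c \<in> x" "b \<preceq> a \<cdot> c"
    using filt_directed_cmp[OF x a(1) b] by blast
  then have "a \<cdot> c \<in> y" using mem_shift[OF x a(1)] mem_shift[OF y a(2)] eq by blast
  then show "b \<in> y" using filt_down[OF y] c b filt_sub[OF x] by blast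
qed

text \<open>The hereditary closure of the composites of \<open>a\<close> with \<open>y\<close>; this
  inverts the shift by \<open>d a\<close> on filters whose members have range
  \<open>s a\<close>.\<close>

definition prepend :: "'a \<Rightarrow> 'a set \<Rightarrow> 'a set" where
  "prepend a y = {b \<in> Lam. \<exists>c\<in>y. b \<preceq> a \<cdot> c}"

lemma
  assumes a: "a \<in> Lam" and y: "filt y" and v: "v \<in> y" "s a = r v"
  shows filt_prepend: "filt (prepend a y)"
    and cmp_mem_prepend: "\<And>c. c \<in> y \<Longrightarrow> a \<cdot> c \<in> prepend a y"
    and shift_prepend: "shift (prepend a y) (d a) = y"
proof -
  \<comment> \<open>All members of a filter share one range, so a single composable \<open>v\<close>
    makes all of \<open>y\<close> composable with \<open>a\<close>.\<close>
  have rng: "c \<in> Lam \<and> s a = r c" if "c \<in> y" for c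
    using that y v filt_sub filt_common_range by metis
  show cm: "a \<cdot> c \<in> prepend a y" if "c \<in> y" for c
    unfolding prepend_def using that rng a cmp_in le_refl by blast
  have am: "a \<in> prepend a y" unfolding prepend_def using a v rng le_cmp by blast
  have "\<exists>w\<in>prepend a y. b \<preceq> w \<and> b' \<preceq> w" if bb: "b \<in> prepend a y" "b' \<in> prepend a y" for b b'
  proof -
    obtain c c' where c: "b \<in> Lam" "b' \<in> Lam" "c \<in> y" "c' \<in> y" "b \<preceq> a \<cdot> c" "b' \<preceq> a \<cdot> c'"
      using bb unfolding prepend_def by blast
    obtain u where u: "u \<in> y" "c \<preceq> u" "c' \<preceq> u" using filt_directed[OF y] c by blast
    then have "a \<cdot> c \<preceq> a \<cdot> u" "a \<cdot> c' \<preceq> a \<cdot> u" using rng c a le_cmp_left_iff by blast+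
    then show ?thesis using c u cm le_trans by blast
  qed
  moreover have "b \<in> prepend a y" if "c \<in> prepend a y" "b \<in> Lam" "b \<preceq> c" for b c
    using that le_trans unfolding prepend_def by blast
  moreover have "prepend a y \<subseteq> Lam" unfolding prepend_def by blast
  ultimately show f: "filt (prepend a y)" using am unfolding is_filter_def by blast
  have "b \<in> y" if b: "b \<in> Lam" "s a = r b" "a \<cdot> b \<in> prepend a y" for b
  proof -
    obtain c where "c \<in> y" "a \<cdot> b \<preceq> a \<cdot> c" using b unfolding prepend_def by blast
    then show ?thesis using b a rng le_cmp_left_iff filt_down[OF y] by blast
  qed
  then show "shift (prepend a y) (d a) = y"
    using mem_shift[OF f am] rng cm by blast
qed

section \<open>The action is directed\<close>

lemma path_action: "semigroup_action P X XP shift"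
  unfolding semigroup_action_def
proof (intro conjI ballI impI)
  show "XP \<subseteq> X \<times> P" unfolding path_act_dom_def by blast
next
  fix x m assume "(x, m) \<in> XP"
  then show "shift x m \<in> X" using shift_in by (auto simp: mem_XP)
next
  fix x assume x: "x \<in> X"
  note f = path_space_filt[OF x]
  obtain a where a: "a \<in> x" using f unfolding is_filter_def by blast
  then have aL: "a \<in> Lam" using f filt_sub by blast
  \<comment> \<open>The identity \<open>r a\<close> is a prefix of \<open>a\<close>, since
    \<open>a\<close> equals \<open>r a \<cdot> a\<close>. It is the segment of degree 0, and
    composing with it changes nothing.\<close>
  then have ra: "r a \<in> x" using filt_down[OF f _ _ a] r_in le_iff s_r r_cmp_id by metis
  then show "(x, 0) \<in> XP" using x aL d_r mem_XP by blast
  have "b \<in> shift x (d (r a)) \<longleftrightarrow> b \<in> x" for b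
    using mem_shift[OF f ra] filt_common_range[OF f a] filt_sub[OF f] s_r[OF aL] r_cmp_id by metis
  then show "shift x 0 = x" using d_r[OF aL] by auto
next
  fix x m n assume x: "x \<in> X" and mn: "m \<in> P" "n \<in> P"
  note f = path_space_filt[OF x]
  \<comment> \<open>Factorising the member of degree \<open>m + n\<close> gives the segment
    \<open>a\<close> of \<open>x\<close> and the segment \<open>b\<close> of the shifted filter;
    conversely their composite has degree \<open>m + n\<close>.\<close>
  have split: "\<exists>a b. a \<in> x \<and> d a = m \<and> b \<in> Lam \<and> s a = r b \<and> a \<cdot> b \<in> x \<and> d b = n"
    if mnx: "(x, m + n) \<in> XP"
  proof -
    obtain c where c: "c \<in> x" "d c = m + n" using mnx mem_XP by blast
    then obtain a b where ab: "a \<in> Lam" "b \<in> Lam" "s a = r b" "a \<cdot> b = c" "d a = m" "d b = n"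
      using factorise filt_sub[OF f] mn by metis
    then have "a \<in> x" using filt_down[OF f] le_cmp c by blast
    then show ?thesis using ab c by blast
  qed
  show "(x, m + n) \<in> XP \<longleftrightarrow> (x, m) \<in> XP \<and> (shift x m, n) \<in> XP"
  proof
    assume "(x, m + n) \<in> XP"
    then obtain a b where ab: "a \<in> x" "d a = m" "b \<in> Lam" "s a = r b" "a \<cdot> b \<in> x" "d b = n"
      using split by blast
    then have "b \<in> shift x m" using mem_shift[OF f] by blast
    then show "(x, m) \<in> XP \<and> (shift x m, n) \<in> XP" using ab x shift_in mem_XP by blast
  next
    assume "(x, m) \<in> XP \<and> (shift x m, n) \<in> XP"
    then obtain a b where ab: "a \<in> x" "d a = m" "b \<in> shift x m" "d b = n"
      unfolding mem_XP by blast
    then have "b \<in> Lam" "s a = r b" "a \<cdot> b \<in> x" using mem_shift[OF f] by blast+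
    then show "(x, m + n) \<in> XP" using ab x mem_XP d_cmp filt_sub[OF f] by blast
  qed
  assume "(x, m + n) \<in> XP"
  then obtain a b where ab: "a \<in> x" "d a = m" "b \<in> Lam" "s a = r b" "a \<cdot> b \<in> x" "d b = n"
    using split by blast
  then have aL: "a \<in> Lam" using filt_sub[OF f] by blast
  have bm: "b \<in> shift x m" using ab mem_shift[OF f] by blast
  have "filt (shift x m)" using filt_shift[OF f] ab by blast
  note shift2 = mem_shift[OF this bm]
  have dab: "d (a \<cdot> b) = m + n" "s (a \<cdot> b) = s b" using ab aL d_cmp s_cmp by blast+
  \<comment> \<open>Shifting twice asks whether \<open>a \<cdot> (b \<cdot> c)\<close> is in
    \<open>x\<close>, shifting once whether \<open>a \<cdot> b \<cdot> c\<close> is; associativity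
    identifies them.\<close>
  have "c \<in> shift (shift x m) n \<longleftrightarrow> c \<in> shift x (m + n)" for c
  proof -
    have "c \<in> shift (shift x m) n \<longleftrightarrow> c \<in> Lam \<and> s b = r c \<and> b \<cdot> c \<in> shift x m"
      using shift2 ab by simp
    also have "\<dots> \<longleftrightarrow> c \<in> Lam \<and> s b = r c \<and> a \<cdot> (b \<cdot> c) \<in> x"
      using mem_shift[OF f ab(1), of "b \<cdot> c"] ab cmp_in r_cmp by auto
    also have "\<dots> \<longleftrightarrow> c \<in> Lam \<and> s b = r c \<and> a \<cdot> b \<cdot> c \<in> x"
      using cmp_assoc ab aL by auto
    also have "\<dots> \<longleftrightarrow> c \<in> shift x (m + n)"
      using mem_shift[OF f ab(5), of c] dab by simp
    finally show ?thesis .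
  qed
  then show "shift (shift x m) n = shift x (m + n)" by blast
qed

section \<open>Directedness, from least upper bounds of degrees\<close>

lemma path_action_directed: "directed_action P XP"
  unfolding directed_action_def
proof (intro ballI impI)
  fix m n assume mn: "m \<in> P" "n \<in> P" and ne: "act_dom XP m \<inter> act_dom XP n \<noteq> {}"
  have upper: "\<exists>c\<in>x. pleq P m (d c) \<and> pleq P n (d c)"
    if "x \<in> act_dom XP m \<inter> act_dom XP n" for x
  proof -
    obtain a b where ab: "x \<in> X" "a \<in> x" "b \<in> x" "d a = m" "d b = n"
      using \<open>x \<in> _\<close> unfolding act_dom_def by (auto simp: mem_XP)
    note f = path_space_filt[OF ab(1)]
    obtain c where "c \<in> x" "a \<preceq> c" "b \<preceq> c" using filt_directed[OF f] ab by blast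
    then show ?thesis using le_degree filt_sub[OF f] ab by blast
  qed
  have in_X: "x \<in> X" if "x \<in> act_dom XP m" for x using that mem_XP unfolding act_dom_def by blast
  \<comment> \<open>A point of the intersection supplies a member whose degree bounds
    \<open>m\<close> and \<open>n\<close>. The weak lattice order then gives a least bound
    \<open>l\<close>, which depends on no point and so serves all of them.\<close>
  have bounded: "\<exists>u\<in>P. pleq P m u \<and> pleq P n u"
    using ne upper in_X filt_sub path_space_filt d_in by (metis Int_iff ex_in_conv)
  have lub: "\<forall>p\<in>P. \<forall>q\<in>P. (\<exists>u\<in>P. pleq P p u \<and> pleq P q u) \<longrightarrow>
      (\<exists>l\<in>P. pleq P p l \<and> pleq P q l \<and> (\<forall>u\<in>P. pleq P p u \<and> pleq P q u \<longrightarrow> pleq P l u))"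
    using weakly_qlo unfolding weakly_qlo_def by (elim conjE)
  have "\<exists>l\<in>P. pleq P m l \<and> pleq P n l \<and>
      (\<forall>u\<in>P. pleq P m u \<and> pleq P n u \<longrightarrow> pleq P l u)"
    using lub[THEN bspec, OF mn(1), THEN bspec, OF mn(2)] bounded by (rule mp)
  then obtain l where l: "l \<in> P" "pleq P m l" "pleq P n l"
    and least: "\<And>u. u \<in> P \<Longrightarrow> pleq P m u \<Longrightarrow> pleq P n u \<Longrightarrow> pleq P l u"
    by (elim bexE conjE) simp
  have "x \<in> act_dom XP l" if x: "x \<in> act_dom XP m \<inter> act_dom XP n" for x
  proof -
    have "x \<in> X" using x in_X by blast
    note f = path_space_filt[OF this]
    obtain c where c: "c \<in> x" "pleq P m (d c)" "pleq P n (d c)" using upper x by blast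
    then have "pleq P l (d c)" using least d_in filt_sub[OF f] by blast
    \<comment> \<open>As \<open>l\<close> lies below the degree of \<open>c\<close>, factorisation
      gives \<open>c\<close> a prefix of degree \<open>l\<close>, which is in \<open>x\<close> by
      heredity.\<close>
    then obtain q where "q \<in> P" "d c = l + q" unfolding pleq_def by metis
    then obtain a b where "a \<in> Lam" "b \<in> Lam" "s a = r b" "a \<cdot> b = c" "d a = l"
      using factorise c l filt_sub[OF f] by metis
    then show ?thesis
      using filt_down[OF f] le_cmp c \<open>x \<in> X\<close> mem_XP unfolding act_dom_def by blast
  qed
  then show "\<exists>l\<in>P. pleq P m l \<and> pleq P n l \<and> act_dom XP m \<inter> act_dom XP n \<subseteq> act_dom XP l"
    using l by blast
qed

section \<open>Cylinders\<close>

text \<open>If \<open>a\<close> is in \<open>falign\<close>, every filter through \<open>a\<close>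
  lies in the path space, so the cylinder consists of all filters containing
  \<open>a\<close>.\<close>

definition cyl :: "'a \<Rightarrow> 'a set set" where
  "cyl a = {x \<in> X. a \<in> x}"

lemma topspace_XT: "topspace XT = X"
  unfolding path_top_def topspace_subtopology topspace_powerset_top using path_space_sub by blast

lemma openin_cyl: "a \<in> Lam \<Longrightarrow> openin XT (cyl a)"
proof -
  assume "a \<in> Lam"
  moreover have "cyl a = {x. x \<subseteq> Lam \<and> a \<in> x} \<inter> X" unfolding cyl_def using path_space_sub by blast
  ultimately show ?thesis
    unfolding path_top_def openin_subtopology by (metis openin_powerset_top_mem)
qed

lemma openin_Diff_cyl: "a \<in> Lam \<Longrightarrow> openin XT (X - cyl a)"
proof -
  assume "a \<in> Lam"
  moreover have "X - cyl a = {x. x \<subseteq> Lam \<and> a \<notin> x} \<inter> X" unfolding cyl_def using path_space_sub by blast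
  ultimately show ?thesis
    unfolding path_top_def openin_subtopology by (metis openin_powerset_top_not_mem)
qed

text \<open>Finite alignment is available only at pairs whose first entry extends \<open>a\<close>, so two members
  \<open>b\<close>, \<open>c\<close> of a limit set are bounded in two steps: bound \<open>a\<close> and \<open>b\<close> by \<open>v\<close>, then \<open>v\<close> and \<open>c\<close>.\<close>

lemma closedin_cyl:
  assumes a: "a \<in> falign"
  shows "closedin (powerset_top Lam) (cyl a)"
proof -
  have aL: "a \<in> Lam" using a FA_in by blast
  have "\<exists>T. openin (powerset_top Lam) T \<and> x \<in> T \<and> T \<subseteq> Pow Lam - cyl a"
    if x: "x \<subseteq> Lam" "x \<notin> cyl a" for x
  proof (rule ccontr)
    assume no_nbhd: "\<nexists>T. openin (powerset_top Lam) T \<and> x \<in> T \<and> T \<subseteq> Pow Lam - cyl a"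
    \<comment> \<open>Since \<open>x\<close> lies in the closure of the cylinder, any finite set of
      memberships and non-memberships of \<open>x\<close> is shared by some filter in the
      cylinder.\<close>
    have approx: "\<exists>y\<in>cyl a. K1 \<subseteq> y \<and> y \<inter> K2 = {}"
      if "finite K1" "finite K2" "K1 \<subseteq> x" "K2 \<subseteq> Lam - x" for K1 K2
    proof (rule ccontr)
      let ?T = "{x. x \<subseteq> Lam \<and> K1 \<subseteq> x \<and> x \<subseteq> Lam - K2}"
      assume "\<not> ?thesis"
      then have "?T \<subseteq> Pow Lam - cyl a" by blast
      moreover have "openin (powerset_top Lam) ?T" "x \<in> ?T"
        using that x openin_powerset_top_basis[of K1 K2 Lam] by blast+
      ultimately show False using no_nbhd by blast
    qed
    have ax: "a \<in> x" using approx[of "{}" "{a}"] aL unfolding cyl_def by blast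
    have down: "c \<in> x" if bc: "b \<in> x" "c \<in> Lam" "c \<preceq> b" for b c
    proof (rule ccontr)
      assume "c \<notin> x"
      then obtain y where "y \<in> cyl a" "b \<in> y" "c \<notin> y" using approx[of "{b}" "{c}"] bc by auto
      then show False using bc filt_down path_space_filt unfolding cyl_def by blast
    qed
    have bound: "\<exists>u\<in>x. b \<preceq> u \<and> c \<preceq> u" if b: "a \<preceq> b" "b \<in> x" and c: "c \<in> x" for b c
    proof (rule ccontr)
      assume none: "\<not> ?thesis"
      obtain J where J: "finite J" "J \<subseteq> Lam" "\<And>u. u \<in> J \<Longrightarrow> b \<preceq> u \<and> c \<preceq> u"
        "\<And>v. b \<preceq> v \<Longrightarrow> c \<preceq> v \<Longrightarrow> \<exists>u\<in>J. u \<preceq> v"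
        using FA_common_ext[OF a b(1) subsetD[OF x(1) c]] by blast
      \<comment> \<open>If no bound were in \<open>x\<close>, all of the finite set \<open>J\<close>
        would be excluded, and so would it be from an approximating filter \<open>y\<close>. But a
        bound of \<open>b\<close> and \<open>c\<close> in \<open>y\<close> lies above an element of
        \<open>J\<close>, which is then in \<open>y\<close>.\<close>
      have "J \<subseteq> Lam - x" using J none by blast
      then obtain y where y: "y \<in> cyl a" "b \<in> y" "c \<in> y" "y \<inter> J = {}"
        using approx[of "{b, c}" J] J(1) b c by auto
      then have f: "filt y" using path_space_filt unfolding cyl_def by blast
      obtain v where "v \<in> y" "b \<preceq> v" "c \<preceq> v" using filt_directed[OF f] y by blast
      then obtain u where "u \<in> J" "u \<in> y" using J filt_down[OF f] by blast
      then show False using y by blast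
    qed
    have "\<exists>u\<in>x. b \<preceq> u \<and> c \<preceq> u" if bc: "b \<in> x" "c \<in> x" for b c
    proof -
      obtain v where v: "v \<in> x" "a \<preceq> v" "b \<preceq> v" using bound[OF le_refl[OF aL] ax] bc by blast
      obtain u where u: "u \<in> x" "v \<preceq> u" "c \<preceq> u" using bound[OF v(2,1)] bc by blast
      then have "b \<preceq> u" using le_trans v bc x by blast
      then show ?thesis using u by blast
    qed
    then have "filt x" using x ax down unfolding is_filter_def by blast
    then have "x \<in> cyl a" using a ax unfolding cyl_def path_space_def by blast
    then show False using x by blast
  qed
  then have "openin (powerset_top Lam) (Pow Lam - cyl a)" by (subst openin_subopen) blast
  then show ?thesis
    unfolding closedin_def topspace_powerset_top using path_space_sub unfolding cyl_def by blast
qed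

text \<open>A closed subset of the compact power set is compact, and compactness does not depend on
  the ambient subspace.\<close>

lemma compactin_cyl: "a \<in> falign \<Longrightarrow> compactin XT (cyl a)"
  unfolding path_top_def compactin_subtopology
  using closedin_compact_space[OF compact_space_powerset_top closedin_cyl]
  by (auto simp: cyl_def)

lemma Hausdorff_XT: "Hausdorff_space XT"
  unfolding path_top_def by (intro Hausdorff_space_subtopology Hausdorff_space_powerset_top)

lemma locally_compact_XT: "locally_compact_space XT"
  unfolding locally_compact_space_def topspace_XT
proof
  fix x assume "x \<in> X"
  then obtain a where "a \<in> falign" "x \<in> cyl a" unfolding path_space_def cyl_def by blast
  then show "\<exists>U K. openin XT U \<and> compactin XT K \<and> x \<in> U \<and> U \<subseteq> K"
    using openin_cyl compactin_cyl FA_in by blast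
qed

section \<open>The shift is a local homeomorphism\<close>

lemma cyl_sub_dom:
  assumes "a \<in> Lam" "b \<in> Lam" "s a = r b"
  shows "cyl (a \<cdot> b) \<subseteq> act_dom XP (d a)"
proof
  fix x assume "x \<in> cyl (a \<cdot> b)"
  then have "x \<in> X" "a \<in> x"
    using assms path_space_filt filt_down le_cmp unfolding cyl_def by blast+
  then show "x \<in> act_dom XP (d a)" using mem_XP unfolding act_dom_def by blast
qed

lemma shift_image_cyl:
  assumes ab: "a \<in> Lam" "b \<in> Lam" "s a = r b" "a \<cdot> b \<in> falign"
  shows "(\<lambda>x. shift x (d a)) ` cyl (a \<cdot> b) = cyl b"
proof (intro subset_antisym subsetI)
  fix y assume "y \<in> (\<lambda>x. shift x (d a)) ` cyl (a \<cdot> b)"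
  then obtain x where x: "x \<in> X" "a \<cdot> b \<in> x" "y = shift x (d a)" unfolding cyl_def by blast
  note f = path_space_filt[OF x(1)]
  have "a \<in> x" using filt_down[OF f] le_cmp ab x by blast
  then show "y \<in> cyl b" using x ab mem_shift[OF f] shift_in unfolding cyl_def by blast
next
  fix y assume "y \<in> cyl b"
  then have y: "filt y" "b \<in> y" using path_space_filt unfolding cyl_def by blast+
  note pre = ab(1) y ab(3)
  \<comment> \<open>The filter belongs to the path space because it contains the finitely aligned
    \<open>a \<cdot> b\<close>.\<close>
  have "prepend a y \<in> cyl (a \<cdot> b)"
    using filt_prepend[OF pre] cmp_mem_prepend[OF pre y(2)] ab(4)
    unfolding cyl_def path_space_def by blast
  then show "y \<in> (\<lambda>x. shift x (d a)) ` cyl (a \<cdot> b)"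
    using shift_prepend[OF pre] by (metis image_eqI)
qed

text \<open>Membership of a composable \<open>c\<close> in the shift is membership of
  \<open>a \<cdot> c\<close> in \<open>x\<close>, a clopen condition; if \<open>c\<close> is not
  composable with \<open>a\<close>, it never holds.\<close>

lemma continuous_map_shift_cyl:
  assumes ab: "a \<in> Lam" "b \<in> Lam" "s a = r b"
  shows "continuous_map (subtopology XT (cyl (a \<cdot> b))) (powerset_top Lam) (\<lambda>x. shift x (d a))"
proof -
  let ?U = "cyl (a \<cdot> b)"
  have top: "topspace (subtopology XT ?U) = ?U"
    unfolding topspace_subtopology topspace_XT cyl_def by blast
  have mem: "c \<in> shift x (d a) \<longleftrightarrow> c \<in> Lam \<and> s a = r c \<and> x \<in> cyl (a \<cdot> c)" if "x \<in> ?U" for x c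
  proof -
    have x: "x \<in> X" "a \<cdot> b \<in> x" using that unfolding cyl_def by blast+
    note f = path_space_filt[OF x(1)]
    have "a \<in> x" using filt_down[OF f] le_cmp ab x by blast
    then show ?thesis using mem_shift[OF f] x unfolding cyl_def by blast
  qed
  show ?thesis
  proof (rule continuous_map_powerset_top)
    fix x assume "x \<in> topspace (subtopology XT ?U)"
    then show "shift x (d a) \<subseteq> Lam" unfolding path_shift_def by blast
  next
    fix c assume c: "c \<in> Lam"
    consider "s a = r c" | "s a \<noteq> r c" by blast
    then have "openin (subtopology XT ?U) {x \<in> ?U. c \<in> shift x (d a)} \<and>
        openin (subtopology XT ?U) {x \<in> ?U. c \<notin> shift x (d a)}"
    proof cases
      case 1
      have "{x \<in> ?U. c \<in> shift x (d a)} = cyl (a \<cdot> c) \<inter> ?U"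
        "{x \<in> ?U. c \<notin> shift x (d a)} = (X - cyl (a \<cdot> c)) \<inter> ?U"
        using mem c 1 unfolding cyl_def by blast+
      then show ?thesis
        using openin_cyl openin_Diff_cyl cmp_in[OF ab(1) c 1] unfolding openin_subtopology by metis
    next
      case 2
      have "{x \<in> ?U. c \<in> shift x (d a)} = {}" "{x \<in> ?U. c \<notin> shift x (d a)} = ?U"
        using mem 2 by blast+
      then show ?thesis using openin_topspace[of "subtopology XT ?U"] unfolding top by (metis openin_empty)
    qed
    then show "openin (subtopology XT ?U) {x \<in> topspace (subtopology XT ?U). c \<in> shift x (d a)}"
      "openin (subtopology XT ?U) {x \<in> topspace (subtopology XT ?U). c \<notin> shift x (d a)}"
      unfolding top by blast+
  qed
qed

text \<open>A continuous bijection from a compact space to a Hausdorff space is a homeomorphism.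
  Compactness is the reason for restricting to a cylinder of an element of
  \<open>falign\<close>.\<close>

lemma homeomorphic_map_shift_cyl:
  assumes ab: "a \<in> Lam" "b \<in> Lam" "s a = r b" "a \<cdot> b \<in> falign"
  shows "homeomorphic_map (subtopology XT (cyl (a \<cdot> b))) (subtopology XT (cyl b)) (\<lambda>x. shift x (d a))"
proof (rule bijective_closed_imp_homeomorphic_map)
  let ?f = "\<lambda>x. shift x (d a)" and ?U = "cyl (a \<cdot> b)"
  note img = shift_image_cyl[OF ab]
  have cylX: "cyl c \<subseteq> X" for c unfolding cyl_def by blast
  have top: "topspace (subtopology XT (cyl c)) = cyl c" for c
    unfolding topspace_subtopology topspace_XT cyl_def by blast
  \<comment> \<open>The codomain is viewed directly inside the power set, where continuity was
    tested.\<close>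
  have "subtopology XT (cyl b) = subtopology (powerset_top Lam) (cyl b)"
    unfolding path_top_def subtopology_subtopology using cylX by (simp add: inf_absorb2)
  then show cont: "continuous_map (subtopology XT ?U) (subtopology XT (cyl b)) ?f"
    using continuous_map_shift_cyl[OF ab(1-3)] img top by (auto simp: continuous_map_in_subtopology)
  show "?f ` topspace (subtopology XT ?U) = topspace (subtopology XT (cyl b))"
    unfolding top by (rule img)
  have "compact_space (subtopology XT ?U)" using compactin_cyl[OF ab(4)] compactin_subspace by blast
  then show "closed_map (subtopology XT ?U) (subtopology XT (cyl b)) ?f"
    using cont Hausdorff_XT
    by (intro continuous_imp_closed_map_gen Hausdorff_imp_kc_space Hausdorff_space_subtopology)
  have "x \<subseteq> y" if "x \<in> ?U" "y \<in> ?U" "?f x = ?f y" for x y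
  proof -
    have "filt x" "filt y" "a \<in> x" "a \<in> y"
      using that ab path_space_filt filt_down le_cmp unfolding cyl_def by blast+
    then show ?thesis using shift_inj that by blast
  qed
  then show "inj_on ?f (topspace (subtopology XT ?U))" unfolding top inj_on_def by blast
qed

text \<open>These cylinders cover the domain, so openness and the local homeomorphism property need
  checking only on them.\<close>

lemma dom_cyl:
  assumes "x \<in> act_dom XP m"
  obtains a b where "a \<in> Lam" "b \<in> Lam" "s a = r b" "a \<cdot> b \<in> falign" "d a = m" "x \<in> cyl (a \<cdot> b)"
proof -
  obtain a where a: "x \<in> X" "a \<in> x" "d a = m" using assms mem_XP unfolding act_dom_def by blast
  obtain b where "b \<in> Lam" "s a = r b" "a \<cdot> b \<in> x" "a \<cdot> b \<in> falign"
    using path_space_FA_extension[OF a(1,2)] by blast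
  then show ?thesis using that a filt_sub path_space_filt unfolding cyl_def by blast
qed

lemma openin_dom: "openin XT (act_dom XP m)"
proof (subst openin_subopen, intro ballI)
  fix x assume "x \<in> act_dom XP m"
  then obtain a b where ab: "a \<in> Lam" "b \<in> Lam" "s a = r b" "a \<cdot> b \<in> falign"
    and m: "d a = m" and x: "x \<in> cyl (a \<cdot> b)"
    by (rule dom_cyl)
  then show "\<exists>T. openin XT T \<and> x \<in> T \<and> T \<subseteq> act_dom XP m"
    using openin_cyl[OF FA_in[OF ab(4)]] cyl_sub_dom[OF ab(1-3)] by metis
qed

text \<open>The shift carries each covering cylinder of the domain onto a cylinder, so the codomain
  is a union of open cylinders.\<close>

lemma openin_cod: "openin XT (act_cod XP shift m)"
proof (subst openin_subopen, intro ballI)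
  fix y assume "y \<in> act_cod XP shift m"
  then obtain x where x: "x \<in> act_dom XP m" "y = shift x m" unfolding act_cod_def by blast
  then obtain a b where ab: "a \<in> Lam" "b \<in> Lam" "s a = r b" "a \<cdot> b \<in> falign"
    and m: "d a = m" and xc: "x \<in> cyl (a \<cdot> b)"
    using dom_cyl by metis
  have "cyl b \<subseteq> act_cod XP shift m" "y \<in> cyl b"
    using shift_image_cyl[OF ab] cyl_sub_dom[OF ab(1-3)] xc x m unfolding act_cod_def by blast+
  then show "\<exists>T. openin XT T \<and> y \<in> T \<and> T \<subseteq> act_cod XP shift m"
    using openin_cyl ab by blast
qed

lemma local_homeo_shift: "local_homeo_on XT (act_dom XP m) (act_cod XP shift m) (\<lambda>x. shift x m)"
  unfolding local_homeo_on_def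
proof (intro conjI ballI)
  show "(\<lambda>x. shift x m) ` act_dom XP m \<subseteq> act_cod XP shift m" unfolding act_cod_def by blast
next
  fix x assume "x \<in> act_dom XP m"
  then obtain a b where ab: "a \<in> Lam" "b \<in> Lam" "s a = r b" "a \<cdot> b \<in> falign"
    and m: "d a = m" and x: "x \<in> cyl (a \<cdot> b)"
    using dom_cyl by metis
  let ?U = "cyl (a \<cdot> b)"
  have img: "(\<lambda>x. shift x m) ` ?U = cyl b" using shift_image_cyl[OF ab] m by simp
  have dom: "?U \<subseteq> act_dom XP m" using cyl_sub_dom[OF ab(1-3)] m by simp
  then have cod: "cyl b \<subseteq> act_cod XP shift m" unfolding img[symmetric] act_cod_def by blast
  show "\<exists>U. x \<in> U \<and> openin (subtopology XT (act_dom XP m)) U \<and>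
      openin (subtopology XT (act_cod XP shift m)) ((\<lambda>x. shift x m) ` U) \<and>
      homeomorphic_map (subtopology XT U) (subtopology XT ((\<lambda>x. shift x m) ` U)) (\<lambda>x. shift x m)"
  proof (intro exI[of _ ?U] conjI x)
    \<comment> \<open>Domain and codomain are open, so for their subsets relative openness is
      openness in the path space.\<close>
    show "openin (subtopology XT (act_dom XP m)) ?U"
      using openin_cyl[OF FA_in[OF ab(4)]] dom by (simp add: openin_open_subtopology openin_dom)
    show "openin (subtopology XT (act_cod XP shift m)) ((\<lambda>x. shift x m) ` ?U)"
      unfolding img using openin_cyl[OF ab(2)] cod by (simp add: openin_open_subtopology openin_cod)
    show "homeomorphic_map (subtopology XT ?U) (subtopology XT ((\<lambda>x. shift x m) ` ?U)) (\<lambda>x. shift x m)"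
      unfolding img using homeomorphic_map_shift_cyl[OF ab] m by simp
  qed
qed

lemma path_action_locally_compact: "locally_compact_action P XT XP shift"
  unfolding locally_compact_action_def
  using locally_compact_XT Hausdorff_XT openin_dom openin_cod local_homeo_shift by blast

end

theorem theorem5p14:
  fixes P :: "'q::group_add set"
    and Lam :: "'a set" and r s :: "'a \<Rightarrow> 'a" and cmp :: "'a \<Rightarrow> 'a \<Rightarrow> 'a"
    and d :: "'a \<Rightarrow> 'q"
  assumes "weakly_qlo P"
    and "P_graph P Lam r s cmp d"
    and "FA Lam r s cmp \<noteq> {}"
  shows "semigroup_action P (path_space Lam r s cmp)
           (path_act_dom P Lam r s cmp d) (path_shift Lam r s cmp d)
       \<and> locally_compact_action P (path_top Lam r s cmp)
           (path_act_dom P Lam r s cmp d) (path_shift Lam r s cmp d)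
       \<and> directed_action P (path_act_dom P Lam r s cmp d)"
proof -
  interpret p_graph P Lam r s cmp d using assms(1,2) by unfold_locales
  show ?thesis using path_action path_action_locally_compact path_action_directed by blast
qed

end
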